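(* Let $\varphi:\mathcal{U}\subseteq\mathbb{R}^n\to\mathbb{R}$ be twice continuously differentiable on the open set $\mathcal{U}$ and suppose $\varphi$ can be written as a codelist with $t=N(\varphi)$ operations. Let $N([\varphi],[\nabla\varphi],[\lambda_\varphi])$ denote the number of operations necessary to calculate the bounds $[\varphi]\subset\mathbb{R}$, $[\nabla\varphi]\subset\mathbb{R}^n$ and $[\lambda_\varphi]\subset\mathbb{R}$ for a given closed hyperrectangle $\mathcal{B}\subset\mathcal{U}$ using the sparse algorithm (Algorithm S, described in the context). Then $$N([\varphi],[\nabla\varphi],[\lambda_\varphi])=\mathcal{O}(n)\,N(\varphi).$$
   Context: **Cost model.** $N(\varphi)$ is the number of operations needed to evaluate $\varphi$ at a point of its domain via its codelist, i.e. $N(\varphi)=t$. $N([\varphi],[\nabla\varphi],[\lambda_\varphi])$ counts basic operations on real numbers (such as additions, multiplications, comparisons, or evaluations of the elementary functions occurring in the codelist). The index sets $\mathcal{I}_k,\mathcal{L}_k$ below depend only on the codelist and not on $\mathcal{B}$; they are determined once when the extended codelist is constructed (which also fixes the applicable rule in each line) and this is not counted. **Notation.** $\mathcal{N}=\{1,\dots,n\}$; for $\mathcal{J}\subseteq\mathcal{N}$, $\mathcal{J}^c=\mathcal{N}\setminus\mathcal{J}$ and $|\mathcal{J}|$ is the cardinality. $\subsetneq$ is strict inclusion. $e_k$ is the $k$-th unit vector. $[a]=[\underline{a},\overline{a}]$ denotes a real interval, or a hyperrectangle $[\underline{a}_1,\overline{a}_1]\times\cdots\times[\underline{a}_m,\overline{a}_m]$.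 For a hyperrectangle $[\nabla y]\subset\mathbb{R}^n$ and nonempty $\mathcal{J}=\{j_1<\dots<j_m\}\subseteq\mathcal{N}$, $[\nabla_{\mathcal{J}}y]\subset\mathbb{R}^m$ is the hyperrectangle of the components $j_1,\dots,j_m$. **Interval arithmetic.** $[a]+[b]=[\underline a+\underline b,\overline a+\overline b]$; $[a][b]=[\min P,\max P]$ with $P=\{\underline a\,\underline b,\underline a\,\overline b,\overline a\,\underline b,\overline a\,\overline b\}$; $1/[a]=[1/\overline a,1/\underline a]$ (requires $0\notin[a]$); $[a]^0=[1,1]$ and, for $m\ge1$, $[a]^m=[\underline a^m,\overline a^m]$ if $\underline a>0$ or $m$ odd, $[\overline a^m,\underline a^m]$ if $\overline a<0$ and $m$ even, $[0,\max\{\underline a^m,\overline a^m\}]$ otherwise; $\sqrt{[a]}=[\sqrt{\underline a},\sqrt{\overline a}]$ (requires $\underline a\ge0$); $\exp([a])=[\exp\underline a,\exp\overline a]$; $\ln([a])=[\ln\underline a,\ln\overline a]$ (requires $\underline a>0$); $[a]+c=[\underline a+c,\overline a+c]$; $c[a]=[c\underline a,c\overline a]$ if $c\ge0$, $[c\overline a,c\underline a]$ otherwise; $-[a]=(-1)[a]$, $[a]-[b]=[a]+(-1)[b]$. For hyperrectangles, operations (including multiplication by an interval) are componentwise. All interval operations used are assumed to be well defined (the stated restrictions hold). **Interval operators.** For hyperrectangles $[a],[b]\subset\mathbb{R}^m$: $[\Lambda_s([a])]=[a]^2$ if $m=1$, and $[0,\sum_{i=1}^m\max\{\underline a_i^2,\overline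 a_i^2\}]$ otherwise; $[\Lambda_t([a],[b])]=2[a][b]$ if $m=1$, and $[-\beta,\beta]+\sum_{i=1}^m[a_i][b_i]$ otherwise, where $\beta=\sqrt{(\sum_i\max\{\underline a_i^2,\overline a_i^2\})(\sum_i\max\{\underline b_i^2,\overline b_i^2\})}$. For real intervals: $[\Lambda_r([a],[b])]=[\min\{\underline a,\underline b\},\max\{\overline a,\overline b\}]$ and $[\Lambda_\star([a],[b],[c])]=\frac12\big[\underline a+\underline b-\sqrt{(\underline a-\underline b)^2+d},\ \overline a+\overline b+\sqrt{(\overline a-\overline b)^2+d}\big]$ with $d=4\max\{\underline c^2,\overline c^2\}$. **Codelist.** $\varphi$ can be written as a codelist with $t$ operations if on $\mathcal{U}$: $y_k=x_k$ for $k=1,\dots,n$; for $k=n+1,\dots,n+t$, $y_k$ is obtained from earlier $y_i$ (and $y_j$), $i,j<k$, by one of the operations: add $y_k=y_i+y_j$; mul $y_k=y_iy_j$; powNat $y_k=y_i^m$ ($m\ge2$ natural); oneOver $y_k=1/y_i$; sqrt $y_k=\sqrt{y_i}$; exp $y_k=\exp(y_i)$; ln $y_k=\ln(y_i)$; addC $y_k=y_i+c$; mulByC $y_k=c\,y_i$ ($c\in\mathbb{R}$ constant); and $\varphi=y_{n+t}$. **Algorithm S** (for $\mathcal{B}=[\underline x_1,\overline x_1]\times\cdots\times[\underline x_n,\overline x_n]$). *Step 1.* For $k=1,\dots,n$: $\mathcal{I}_k=\mathcal{N}\setminus\{k\}$, $\mathcal{L}_k=\mathcal{N}$, $[y_k]=[\underline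 x_k,\overline x_k]$, $[\nabla y_k]=[e_k,e_k]$, $[\lambda_k^\dagger]=[0,0]$. *Step 2.* For $k=n+1,\dots,n+t$: (a) Index sets: add: $\mathcal{I}_k=\mathcal{I}_i\cap\mathcal{I}_j$, $\mathcal{L}_k=\mathcal{L}_i\cap\mathcal{L}_j$; mul: $\mathcal{I}_k=\mathcal{L}_k=\mathcal{I}_i\cap\mathcal{I}_j$; powNat, oneOver, sqrt, exp, ln: $\mathcal{I}_k=\mathcal{L}_k=\mathcal{I}_i$; addC, mulByC: $\mathcal{I}_k=\mathcal{I}_i$, $\mathcal{L}_k=\mathcal{L}_i$. (b) $[y_k]$ and $[\nabla y_k]$: add: $[y_i]+[y_j]$, $[\nabla y_i]+[\nabla y_j]$; mul: $[y_i][y_j]$, $[y_j][\nabla y_i]+[y_i][\nabla y_j]$; powNat: $[y_i]^m$, $m[y_i]^{m-1}[\nabla y_i]$; oneOver: $1/[y_i]$, $-[y_k]^2[\nabla y_i]$; sqrt: $\sqrt{[y_i]}$, $(1/(2[y_k]))[\nabla y_i]$; exp: $\exp([y_i])$, $[y_k][\nabla y_i]$; ln: $\ln([y_i])$, $(1/[y_i])[\nabla y_i]$; addC: $[y_i]+c$, $[\nabla y_i]$; mulByC: $c[y_i]$, $c[\nabla y_i]$. (c) $[\lambda_k^\dagger]$, with $[\lambda_{i,0}]=[\min\{\underline\lambda_i^\dagger,0\},\max\{\overline\lambda_i^\dagger,0\}]$, likewise $[\lambda_{j,0}]$; $\mathcal{L}_\cup=\mathcal{L}_i\cup\mathcal{L}_j$,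 $\mathcal{L}_\cap=\mathcal{L}_i\cap\mathcal{L}_j$; $[\lambda_t]=[\Lambda_t([\nabla_{\mathcal{L}_k^c}y_i],[\nabla_{\mathcal{L}_k^c}y_j])]$; $[\Lambda_s]$ short for $[\Lambda_s([\nabla_{\mathcal{L}_k^c}y_i])]$; $[\gamma]=[\nabla_{\mathcal{I}_i^c}y_i][\nabla_{\mathcal{I}_j^c}y_j]$; condition $C_\star$: $\mathcal{I}_i\cup\mathcal{I}_j=\mathcal{N}$ and $|\mathcal{I}_i|=|\mathcal{I}_j|=n-1$. add: - $[0,0]$ if $\mathcal{L}_i=\mathcal{L}_j=\mathcal{N}$; - $[\lambda_i^\dagger]$ if $\mathcal{L}_i\subsetneq\mathcal{N}=\mathcal{L}_j$; - $[\lambda_j^\dagger]$ if $\mathcal{L}_j\subsetneq\mathcal{N}=\mathcal{L}_i$; - $[\Lambda_r([\lambda_i^\dagger],[\lambda_j^\dagger])]$ if $\mathcal{L}_i,\mathcal{L}_j\subsetneq\mathcal{N}$, $\mathcal{L}_\cup=\mathcal{N}$; - and if $\mathcal{L}_\cup\subsetneq\mathcal{N}$: $[\lambda_i^\dagger]+[\lambda_j^\dagger]$ if $\mathcal{L}_i=\mathcal{L}_j$; $[\lambda_i^\dagger]+[\lambda_{j,0}]$ if $\mathcal{L}_i\subsetneq\mathcal{L}_j$; $[\lambda_{i,0}]+[\lambda_j^\dagger]$ if $\mathcal{L}_j\subsetneq\mathcal{L}_i$; $[\lambda_{i,0}]+[\lambda_{j,0}]$ if $\mathcal{L}_i\nsubseteq\mathcal{L}_j$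 and $\mathcal{L}_j\nsubseteq\mathcal{L}_i$. mul: - $[\lambda_t]$ if $\mathcal{L}_i=\mathcal{L}_j=\mathcal{N}$; - if $\mathcal{L}_i\subsetneq\mathcal{N}=\mathcal{L}_j$: $[\lambda_t]+[y_j][\lambda_i^\dagger]$ if $\mathcal{L}_k=\mathcal{L}_i$; $[\lambda_t]+[y_j][\lambda_{i,0}]$ if $\mathcal{L}_k\subsetneq\mathcal{L}_i$ and not $C_\star$; $[\Lambda_\star([y_j][\lambda_i^\dagger],[0,0],[\gamma])]$ if $C_\star$; - if $\mathcal{L}_j\subsetneq\mathcal{N}=\mathcal{L}_i$: $[\lambda_t]+[y_i][\lambda_j^\dagger]$ if $\mathcal{L}_k=\mathcal{L}_j$; $[\lambda_t]+[y_i][\lambda_{j,0}]$ if $\mathcal{L}_k\subsetneq\mathcal{L}_j$ and not $C_\star$; $[\Lambda_\star([0,0],[y_i][\lambda_j^\dagger],[\gamma])]$ if $C_\star$; - if $\mathcal{L}_i,\mathcal{L}_j\subsetneq\mathcal{N}$ and $C_\star$: $[\Lambda_\star([y_j][\lambda_i^\dagger],[y_i][\lambda_j^\dagger],[\gamma])]$; - if $\mathcal{L}_i,\mathcal{L}_j\subsetneq\mathcal{N}$, $\mathcal{L}_\cup=\mathcal{N}$: $[\lambda_t]+[\Lambda_r([\Lambda_r([y_j][\lambda_i^\dagger],[y_i][\lambda_j^\dagger])],[0,0])]$ if $\mathcal{L}_k\subsetneq\mathcal{L}_\cap$; $[\lambda_t]+[\Lambda_r([y_j][\lambda_i^\dagger],[y_i][\lambda_j^\dagger])]$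 if $\mathcal{L}_k=\mathcal{L}_\cap$ and not $C_\star$; - if $\mathcal{L}_\cup\subsetneq\mathcal{N}$: $[\lambda_t]+[y_j][\lambda_i^\dagger]+[y_i][\lambda_j^\dagger]$ if $\mathcal{L}_k=\mathcal{L}_i=\mathcal{L}_j$; $[\lambda_t]+[y_j][\lambda_i^\dagger]+[y_i][\lambda_{j,0}]$ if $\mathcal{L}_k=\mathcal{L}_i\subsetneq\mathcal{L}_j$; $[\lambda_t]+[y_j][\lambda_{i,0}]+[y_i][\lambda_j^\dagger]$ if $\mathcal{L}_k=\mathcal{L}_j\subsetneq\mathcal{L}_i$; $[\lambda_t]+[\Lambda_r([y_j][\lambda_i^\dagger]+[y_i][\lambda_j^\dagger],[0,0])]$ if $\mathcal{L}_k\subsetneq\mathcal{L}_i=\mathcal{L}_j$; $[\lambda_t]+[\Lambda_r([y_j][\lambda_i^\dagger]+[y_i][\lambda_{j,0}],[0,0])]$ if $\mathcal{L}_k\subsetneq\mathcal{L}_i\subsetneq\mathcal{L}_j$; $[\lambda_t]+[\Lambda_r([y_j][\lambda_{i,0}]+[y_i][\lambda_j^\dagger],[0,0])]$ if $\mathcal{L}_k\subsetneq\mathcal{L}_j\subsetneq\mathcal{L}_i$; $[\lambda_t]+[y_j][\lambda_{i,0}]+[y_i][\lambda_{j,0}]$ if $\mathcal{L}_i\nsubseteq\mathcal{L}_j$ and $\mathcal{L}_j\nsubseteq\mathcal{L}_i$. Unary nonlinear operations: if $\mathcal{L}_i=\mathcal{N}$: powNat $m(m-1)[y_i]^{m-2}[\Lambda_s]$;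 oneOver $2[y_k]^3[\Lambda_s]$; sqrt $(1/(-4[y_k]^3))[\Lambda_s]$; exp $[y_k][\Lambda_s]$; ln $(-1/[y_i]^2)[\Lambda_s]$. If $\mathcal{L}_i\subsetneq\mathcal{N}$, put $[\mu]=[\lambda_i^\dagger]$ when $\mathcal{L}_k=\mathcal{L}_i$ and $[\mu]=[\lambda_{i,0}]$ when $\mathcal{L}_k\subsetneq\mathcal{L}_i$: powNat $m[y_i]^{m-2}((m-1)[\Lambda_s]+[y_i][\mu])$; oneOver $[y_k]^2(2[y_k][\Lambda_s]-[\mu])$; sqrt $(1/(2[y_k]))\big((1/(-2[y_i]))[\Lambda_s]+[\mu]\big)$; exp $[y_k]([\Lambda_s]+[\mu])$; ln $(1/[y_i])\big([\mu]-(1/[y_i])[\Lambda_s]\big)$. addC, mulByC: $[0,0]$ if $\mathcal{L}_i=\mathcal{N}$; otherwise $[\lambda_i^\dagger]$ (addC), $c[\lambda_i^\dagger]$ (mulByC). *Step 3.* $[\varphi]=[y_{n+t}]$, $[\nabla\varphi]=[\nabla y_{n+t}]$, and $[\lambda_\varphi]=[\lambda_{n+t}^\dagger]$ if $\mathcal{L}_{n+t}=\emptyset$; $[\lambda_\varphi]=[0,0]$ if $\mathcal{L}_{n+t}=\mathcal{N}$; $[\lambda_\varphi]=[\min\{\underline\lambda_{n+t}^\dagger,0\},\max\{\overline\lambda_{n+t}^\dagger,0\}]$ otherwise. *)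

theory Defs
  imports "HOL-Analysis.Analysis" "HOL-Library.Landau_Symbols" "HOL-Library.Monad_Syntax"
begin

text \<open>
  The dimension \<open>n\<close> is quantified inside the statement, so points of \<open>\<real>\<^sup>n\<close> are the elements of
  \<^term>\<open>topspace (Euclidean_space n)\<close>: functions on \<^typ>\<open>nat\<close> that vanish from index \<open>n\<close> on.
  All indices are shifted to start at \<open>0\<close>: the index set of the coordinates is \<^term>\<open>{..<n}\<close>, and
  the lines of a codelist with \<open>t\<close> operations are numbered \<open>0, \<dots>, n + t - 1\<close>.
\<close>

subsection \<open>Twice continuously differentiable functions\<close>

definition partial_deriv :: "nat \<Rightarrow> ((nat \<Rightarrow> real) \<Rightarrow> real) \<Rightarrow> (nat \<Rightarrow> real) \<Rightarrow> real" where
  "partial_deriv i f x = deriv (\<lambda>s. f (x(i := s))) (x i)"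

definition C1_on :: "nat \<Rightarrow> (nat \<Rightarrow> real) set \<Rightarrow> ((nat \<Rightarrow> real) \<Rightarrow> real) \<Rightarrow> bool" where
  "C1_on n U f \<longleftrightarrow>
     (\<forall>i<n. (\<forall>x\<in>U. (\<lambda>s. f (x(i := s))) differentiable (at (x i))) \<and>
            continuous_map (subtopology (Euclidean_space n) U) euclideanreal (partial_deriv i f))"

definition C2_on :: "nat \<Rightarrow> (nat \<Rightarrow> real) set \<Rightarrow> ((nat \<Rightarrow> real) \<Rightarrow> real) \<Rightarrow> bool" where
  "C2_on n U f \<longleftrightarrow> C1_on n U f \<and> (\<forall>i<n. C1_on n U (partial_deriv i f))"

definition hyperrect :: "nat \<Rightarrow> (nat \<Rightarrow> real) \<Rightarrow> (nat \<Rightarrow> real) \<Rightarrow> (nat \<Rightarrow> real) set" where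
  "hyperrect n a b = {x \<in> topspace (Euclidean_space n). \<forall>i<n. a i \<le> x i \<and> x i \<le> b i}"

subsection \<open>Codelists\<close>

datatype oper =
    Add nat nat | Mul nat nat | PowNat nat nat | OneOver nat | Sqrt nat | Exp nat | Ln nat
  | AddC nat real | MulByC real nat

type_synonym codelist = "oper list"

text \<open>\<open>PowNat i m\<close> is the operation \<open>y\<^sub>i\<^sup>m\<close>, with \<open>m \<ge> 2\<close>.\<close>

fun wf_oper :: "nat \<Rightarrow> oper \<Rightarrow> bool" where
  "wf_oper k (Add i j) \<longleftrightarrow> i < k \<and> j < k"
| "wf_oper k (Mul i j) \<longleftrightarrow> i < k \<and> j < k"
| "wf_oper k (PowNat i m) \<longleftrightarrow> i < k \<and> 2 \<le> m"
| "wf_oper k (OneOver i) \<longleftrightarrow> i < k"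
| "wf_oper k (Sqrt i) \<longleftrightarrow> i < k"
| "wf_oper k (Exp i) \<longleftrightarrow> i < k"
| "wf_oper k (Ln i) \<longleftrightarrow> i < k"
| "wf_oper k (AddC i c) \<longleftrightarrow> i < k"
| "wf_oper k (MulByC c i) \<longleftrightarrow> i < k"

definition wf_codelist :: "nat \<Rightarrow> codelist \<Rightarrow> bool" where
  "wf_codelist n cs \<longleftrightarrow> (\<forall>p<length cs. wf_oper (n + p) (cs ! p))"

fun oper_value :: "real list \<Rightarrow> oper \<Rightarrow> real" where
  "oper_value ys (Add i j) = ys ! i + ys ! j"
| "oper_value ys (Mul i j) = ys ! i * ys ! j"
| "oper_value ys (PowNat i m) = (ys ! i) ^ m"
| "oper_value ys (OneOver i) = 1 / ys ! i"
| "oper_value ys (Sqrt i) = sqrt (ys ! i)"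
| "oper_value ys (Exp i) = exp (ys ! i)"
| "oper_value ys (Ln i) = ln (ys ! i)"
| "oper_value ys (AddC i c) = ys ! i + c"
| "oper_value ys (MulByC c i) = c * ys ! i"

fun oper_defined :: "real list \<Rightarrow> oper \<Rightarrow> bool" where
  "oper_defined ys (OneOver i) \<longleftrightarrow> ys ! i \<noteq> 0"
| "oper_defined ys (Sqrt i) \<longleftrightarrow> 0 \<le> ys ! i"
| "oper_defined ys (Ln i) \<longleftrightarrow> 0 < ys ! i"
| "oper_defined ys _ \<longleftrightarrow> True"

fun codelist_values :: "real list \<Rightarrow> codelist \<Rightarrow> real list" where
  "codelist_values ys [] = ys"
| "codelist_values ys (c # cs) = codelist_values (ys @ [oper_value ys c]) cs"

fun codelist_defined :: "real list \<Rightarrow> codelist \<Rightarrow> bool" where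
  "codelist_defined ys [] \<longleftrightarrow> True"
| "codelist_defined ys (c # cs) \<longleftrightarrow>
     oper_defined ys c \<and> codelist_defined (ys @ [oper_value ys c]) cs"

definition is_codelist_of ::
  "nat \<Rightarrow> (nat \<Rightarrow> real) set \<Rightarrow> ((nat \<Rightarrow> real) \<Rightarrow> real) \<Rightarrow> codelist \<Rightarrow> bool" where
  "is_codelist_of n U \<phi> cs \<longleftrightarrow>
     wf_codelist n cs \<and>
     (\<forall>x\<in>U. codelist_defined (map x [0..<n]) cs \<and>
             \<phi> x = last (codelist_values (map x [0..<n]) cs))"

definition codelist_ops :: "codelist \<Rightarrow> nat" where
  "codelist_ops cs = length cs"

subsection \<open>Calculations with operation count\<close>

text \<open>
  \<open>Calc v N\<close> is a calculation with result \<open>v\<close> that takes \<open>N\<close> basic operations on real numbers;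
  \<open>Undef\<close> is a calculation in which a restriction of an interval operation is violated.
  Real numbers are combined only by the primitives below, each of which counts as one operation.
  Constants, copying, and index manipulations are free, and so is \<open>require\<close>, which states an
  assumption and is not part of the calculation.
\<close>

datatype 'a calc = Undef | Calc 'a nat

fun calc_bind :: "'a calc \<Rightarrow> ('a \<Rightarrow> 'b calc) \<Rightarrow> 'b calc" where
  "calc_bind Undef f = Undef"
| "calc_bind (Calc v N) f = (case f v of Undef \<Rightarrow> Undef | Calc w M \<Rightarrow> Calc w (N + M))"

adhoc_overloading Monad_Syntax.bind \<rightleftharpoons> calc_bind

definition ret :: "'a \<Rightarrow> 'a calc" where "ret v = Calc v 0"

definition require :: "bool \<Rightarrow> unit calc" where
  "require P = (if P then Calc () 0 else Undef)"

definition radd :: "real \<Rightarrow> real \<Rightarrow> real calc" where "radd x y = Calc (x + y) 1"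
definition rsub :: "real \<Rightarrow> real \<Rightarrow> real calc" where "rsub x y = Calc (x - y) 1"
definition rmul :: "real \<Rightarrow> real \<Rightarrow> real calc" where "rmul x y = Calc (x * y) 1"
definition rdiv :: "real \<Rightarrow> real \<Rightarrow> real calc" where "rdiv x y = Calc (x / y) 1"
definition rpow :: "real \<Rightarrow> nat \<Rightarrow> real calc" where "rpow x m = Calc (x ^ m) 1"
definition rsqrt :: "real \<Rightarrow> real calc" where "rsqrt x = Calc (sqrt x) 1"
definition rexp :: "real \<Rightarrow> real calc" where "rexp x = Calc (exp x) 1"
definition rln :: "real \<Rightarrow> real calc" where "rln x = Calc (ln x) 1"
definition rmin :: "real \<Rightarrow> real \<Rightarrow> real calc" where "rmin x y = Calc (min x y) 1"
definition rmax :: "real \<Rightarrow> real \<Rightarrow> real calc" where "rmax x y = Calc (max x y) 1"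
definition rless :: "real \<Rightarrow> real \<Rightarrow> bool calc" where "rless x y = Calc (x < y) 1"
definition rleq :: "real \<Rightarrow> real \<Rightarrow> bool calc" where "rleq x y = Calc (x \<le> y) 1"

fun calc_map :: "('a \<Rightarrow> 'b calc) \<Rightarrow> 'a list \<Rightarrow> 'b list calc" where
  "calc_map f [] = ret []"
| "calc_map f (x # xs) = do { y \<leftarrow> f x; ys \<leftarrow> calc_map f xs; ret (y # ys) }"

definition calc_map2 :: "('a \<Rightarrow> 'b \<Rightarrow> 'c calc) \<Rightarrow> 'a list \<Rightarrow> 'b list \<Rightarrow> 'c list calc" where
  "calc_map2 f xs ys = calc_map (\<lambda>(x, y). f x y) (zip xs ys)"

text \<open>The sum of \<open>m \<ge> 1\<close> terms takes \<open>m - 1\<close> additions; \<open>z\<close> is the value of the empty sum.\<close>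

fun calc_sum :: "('a \<Rightarrow> 'a \<Rightarrow> 'a calc) \<Rightarrow> 'a \<Rightarrow> 'a list \<Rightarrow> 'a calc" where
  "calc_sum f z [] = ret z"
| "calc_sum f z [x] = ret x"
| "calc_sum f z (x # y # xs) = do { s \<leftarrow> calc_sum f z (y # xs); f x s }"

subsection \<open>Interval arithmetic\<close>

type_synonym ival = "real \<times> real"

fun iadd :: "ival \<Rightarrow> ival \<Rightarrow> ival calc" where
  "iadd (al, au) (bl, bu) = do { l \<leftarrow> radd al bl; u \<leftarrow> radd au bu; ret (l, u) }"

fun imul :: "ival \<Rightarrow> ival \<Rightarrow> ival calc" where
  "imul (al, au) (bl, bu) = do {
     p1 \<leftarrow> rmul al bl; p2 \<leftarrow> rmul al bu; p3 \<leftarrow> rmul au bl; p4 \<leftarrow> rmul au bu;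
     l1 \<leftarrow> rmin p1 p2; l2 \<leftarrow> rmin p3 p4; l \<leftarrow> rmin l1 l2;
     u1 \<leftarrow> rmax p1 p2; u2 \<leftarrow> rmax p3 p4; u \<leftarrow> rmax u1 u2;
     ret (l, u) }"

fun iinv :: "ival \<Rightarrow> ival calc" where
  "iinv (al, au) = do {
     require (\<not> (al \<le> 0 \<and> 0 \<le> au));
     l \<leftarrow> rdiv 1 au; u \<leftarrow> rdiv 1 al; ret (l, u) }"

fun ipow :: "ival \<Rightarrow> nat \<Rightarrow> ival calc" where
  "ipow (al, au) m =
     (if m = 0 then ret (1, 1)
      else do {
        l \<leftarrow> rpow al m; u \<leftarrow> rpow au m;
        pos \<leftarrow> rless 0 al;
        if pos \<or> odd m then ret (l, u)
        else do {
          neg \<leftarrow> rless au 0;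
          if neg then ret (u, l) else do { w \<leftarrow> rmax l u; ret (0, w) } } })"

fun isqrt :: "ival \<Rightarrow> ival calc" where
  "isqrt (al, au) = do { require (0 \<le> al); l \<leftarrow> rsqrt al; u \<leftarrow> rsqrt au; ret (l, u) }"

fun iexp :: "ival \<Rightarrow> ival calc" where
  "iexp (al, au) = do { l \<leftarrow> rexp al; u \<leftarrow> rexp au; ret (l, u) }"

fun iln :: "ival \<Rightarrow> ival calc" where
  "iln (al, au) = do { require (0 < al); l \<leftarrow> rln al; u \<leftarrow> rln au; ret (l, u) }"

fun iaddc :: "ival \<Rightarrow> real \<Rightarrow> ival calc" where
  "iaddc (al, au) c = do { l \<leftarrow> radd al c; u \<leftarrow> radd au c; ret (l, u) }"

fun iscale :: "real \<Rightarrow> ival \<Rightarrow> ival calc" where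
  "iscale c (al, au) = do {
     nonneg \<leftarrow> rleq 0 c; l \<leftarrow> rmul c al; u \<leftarrow> rmul c au;
     ret (if nonneg then (l, u) else (u, l)) }"

definition ineg :: "ival \<Rightarrow> ival calc" where
  "ineg A = iscale (-1) A"

definition isub :: "ival \<Rightarrow> ival \<Rightarrow> ival calc" where
  "isub A B = do { C \<leftarrow> iscale (-1) B; iadd A C }"

text \<open>\<open>[min {l, 0}, max {u, 0}]\<close>, as in \<open>[\<lambda>\<^bsub>i,0\<^esub>]\<close>.\<close>

fun ihull0 :: "ival \<Rightarrow> ival calc" where
  "ihull0 (al, au) = do { l \<leftarrow> rmin al 0; u \<leftarrow> rmax au 0; ret (l, u) }"

text \<open>
  A hyperrectangle is the list of its component intervals; \<open>[\<nabla>\<^bsub>J\<^esub>y]\<close> is \<open>nths g J\<close> for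
  \<open>g = [\<nabla>y]\<close>.
\<close>

type_synonym irect = "ival list"

definition vadd :: "irect \<Rightarrow> irect \<Rightarrow> irect calc" where
  "vadd = calc_map2 iadd"

definition vmul :: "ival \<Rightarrow> irect \<Rightarrow> irect calc" where
  "vmul A = calc_map (imul A)"

definition vscale :: "real \<Rightarrow> irect \<Rightarrow> irect calc" where
  "vscale c = calc_map (iscale c)"

subsection \<open>Interval operators\<close>

fun max_square :: "ival \<Rightarrow> real calc" where
  "max_square (al, au) = do { l \<leftarrow> rpow al 2; u \<leftarrow> rpow au 2; rmax l u }"

definition sum_max_squares :: "irect \<Rightarrow> real calc" where
  "sum_max_squares g = do { qs \<leftarrow> calc_map max_square g; calc_sum radd 0 qs }"

definition Lambda_s :: "irect \<Rightarrow> ival calc" where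
  "Lambda_s g =
     (if length g = 1 then ipow (hd g) 2
      else do { s \<leftarrow> sum_max_squares g; ret (0, s) })"

definition Lambda_t :: "irect \<Rightarrow> irect \<Rightarrow> ival calc" where
  "Lambda_t g h =
     (if length g = 1 then do { A \<leftarrow> iscale 2 (hd g); imul A (hd h) }
      else do {
        sg \<leftarrow> sum_max_squares g; sh \<leftarrow> sum_max_squares h;
        p \<leftarrow> rmul sg sh; \<beta> \<leftarrow> rsqrt p; \<beta>' \<leftarrow> rmul (-1) \<beta>;
        ps \<leftarrow> calc_map2 imul g h; s \<leftarrow> calc_sum iadd (0, 0) ps;
        iadd (\<beta>', \<beta>) s })"

fun Lambda_r :: "ival \<Rightarrow> ival \<Rightarrow> ival calc" where
  "Lambda_r (al, au) (bl, bu) = do { l \<leftarrow> rmin al bl; u \<leftarrow> rmax au bu; ret (l, u) }"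

fun Lambda_star :: "ival \<Rightarrow> ival \<Rightarrow> ival \<Rightarrow> ival calc" where
  "Lambda_star (al, au) (bl, bu) C = do {
     q \<leftarrow> max_square C; d \<leftarrow> rmul 4 q;
     dl \<leftarrow> rsub al bl; dl2 \<leftarrow> rpow dl 2; el \<leftarrow> radd dl2 d; rl \<leftarrow> rsqrt el;
     du \<leftarrow> rsub au bu; du2 \<leftarrow> rpow du 2; eu \<leftarrow> radd du2 d; ru \<leftarrow> rsqrt eu;
     sl \<leftarrow> radd al bl; l \<leftarrow> rsub sl rl;
     su \<leftarrow> radd au bu; u \<leftarrow> radd su ru;
     iscale (1/2) (l, u) }"

subsection \<open>Index sets\<close>

text \<open>
  Each line carries the pair of its sets \<open>I\<^sub>k\<close> and \<open>L\<^sub>k\<close>. They depend on the codelist only,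
  and determining them is not counted.
\<close>

type_synonym isets = "nat set \<times> nat set"

fun oper_isets :: "isets list \<Rightarrow> oper \<Rightarrow> isets" where
  "oper_isets S (Add i j) = (fst (S ! i) \<inter> fst (S ! j), snd (S ! i) \<inter> snd (S ! j))"
| "oper_isets S (Mul i j) = (fst (S ! i) \<inter> fst (S ! j), fst (S ! i) \<inter> fst (S ! j))"
| "oper_isets S (PowNat i m) = (fst (S ! i), fst (S ! i))"
| "oper_isets S (OneOver i) = (fst (S ! i), fst (S ! i))"
| "oper_isets S (Sqrt i) = (fst (S ! i), fst (S ! i))"
| "oper_isets S (Exp i) = (fst (S ! i), fst (S ! i))"
| "oper_isets S (Ln i) = (fst (S ! i), fst (S ! i))"
| "oper_isets S (AddC i c) = (fst (S ! i), snd (S ! i))"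
| "oper_isets S (MulByC c i) = (fst (S ! i), snd (S ! i))"

fun extend_isets :: "isets list \<Rightarrow> codelist \<Rightarrow> isets list" where
  "extend_isets S [] = S"
| "extend_isets S (c # cs) = extend_isets (S @ [oper_isets S c]) cs"

definition codelist_isets :: "nat \<Rightarrow> codelist \<Rightarrow> isets list" where
  "codelist_isets n cs = extend_isets (map (\<lambda>k. ({..<n} - {k}, {..<n})) [0..<n]) cs"

subsection \<open>Eigenvalue bounds for a single line\<close>

definition lambda_add :: "nat \<Rightarrow> nat set \<Rightarrow> nat set \<Rightarrow> ival \<Rightarrow> ival \<Rightarrow> ival calc" where
  "lambda_add n Li Lj li lj = (let N = {..<n} in
     if Li = N \<and> Lj = N then ret (0, 0)
     else if Li \<subset> N \<and> Lj = N then ret li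
     else if Lj \<subset> N \<and> Li = N then ret lj
     else if Li \<union> Lj = N then Lambda_r li lj
     else if Li = Lj then iadd li lj
     else if Li \<subset> Lj then do { lj0 \<leftarrow> ihull0 lj; iadd li lj0 }
     else if Lj \<subset> Li then do { li0 \<leftarrow> ihull0 li; iadd li0 lj }
     else do { li0 \<leftarrow> ihull0 li; lj0 \<leftarrow> ihull0 lj; iadd li0 lj0 })"

definition C_star :: "nat \<Rightarrow> nat set \<Rightarrow> nat set \<Rightarrow> bool" where
  "C_star n Ii Ij \<longleftrightarrow> Ii \<union> Ij = {..<n} \<and> card Ii = n - 1 \<and> card Ij = n - 1"

text \<open>
  The sets satisfy \<open>L\<^sub>k = I\<^sub>i \<inter> I\<^sub>j \<subseteq> L\<^sub>i \<inter> L\<^sub>j\<close>, since always \<open>I\<^sub>i \<subseteq> L\<^sub>i\<close>, so the last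
  alternative of each group of cases needs no condition. If \<open>C\<^sub>\<star>\<close> holds, then
  \<open>L\<^sub>k \<noteq> L\<^sub>i, L\<^sub>j\<close>, and \<open>L\<^sub>k = L\<^sub>i \<inter> L\<^sub>j\<close> if \<open>L\<^sub>i\<close> and \<open>L\<^sub>j\<close> are proper, so
  testing \<open>C\<^sub>\<star>\<close> first does not interfere with the other cases.
\<close>

definition lambda_mul ::
  "nat \<Rightarrow> isets \<Rightarrow> isets \<Rightarrow> nat set \<Rightarrow> ival \<Rightarrow> irect \<Rightarrow> ival \<Rightarrow> ival \<Rightarrow> irect \<Rightarrow> ival \<Rightarrow> ival calc" where
  "lambda_mul n Si Sj Lk yi gi li yj gj lj = (
     let N = {..<n}; (Ii, Li) = Si; (Ij, Lj) = Sj;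
         lt = Lambda_t (nths gi (N - Lk)) (nths gj (N - Lk));
         gamma = imul (hd (nths gi (N - Ii))) (hd (nths gj (N - Ij)))
     in
     if Li = N \<and> Lj = N then lt
     else if Li \<subset> N \<and> Lj = N then
       (if C_star n Ii Ij then do {
          A \<leftarrow> imul yj li; G \<leftarrow> gamma; Lambda_star A (0, 0) G }
        else if Lk = Li then do {
          T \<leftarrow> lt; A \<leftarrow> imul yj li; iadd T A }
        else do {
          T \<leftarrow> lt; li0 \<leftarrow> ihull0 li; A \<leftarrow> imul yj li0; iadd T A })
     else if Lj \<subset> N \<and> Li = N then
       (if C_star n Ii Ij then do {
          B \<leftarrow> imul yi lj; G \<leftarrow> gamma; Lambda_star (0, 0) B G }
        else if Lk = Lj then do {
          T \<leftarrow> lt; B \<leftarrow> imul yi lj; iadd T B }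
        else do {
          T \<leftarrow> lt; lj0 \<leftarrow> ihull0 lj; B \<leftarrow> imul yi lj0; iadd T B })
     else if C_star n Ii Ij then do {
       A \<leftarrow> imul yj li; B \<leftarrow> imul yi lj; G \<leftarrow> gamma; Lambda_star A B G }
     else if Li \<union> Lj = N then
       (if Lk \<subset> Li \<inter> Lj then do {
          T \<leftarrow> lt; A \<leftarrow> imul yj li; B \<leftarrow> imul yi lj;
          R \<leftarrow> Lambda_r A B; R0 \<leftarrow> Lambda_r R (0, 0); iadd T R0 }
        else do {
          T \<leftarrow> lt; A \<leftarrow> imul yj li; B \<leftarrow> imul yi lj;
          R \<leftarrow> Lambda_r A B; iadd T R })
     else if Lk = Li \<and> Li = Lj then do {
       T \<leftarrow> lt; A \<leftarrow> imul yj li; B \<leftarrow> imul yi lj;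
       TA \<leftarrow> iadd T A; iadd TA B }
     else if Lk = Li \<and> Li \<subset> Lj then do {
       T \<leftarrow> lt; A \<leftarrow> imul yj li; lj0 \<leftarrow> ihull0 lj; B \<leftarrow> imul yi lj0;
       TA \<leftarrow> iadd T A; iadd TA B }
     else if Lk = Lj \<and> Lj \<subset> Li then do {
       T \<leftarrow> lt; li0 \<leftarrow> ihull0 li; A \<leftarrow> imul yj li0; B \<leftarrow> imul yi lj;
       TA \<leftarrow> iadd T A; iadd TA B }
     else if Lk \<subset> Li \<and> Li = Lj then do {
       T \<leftarrow> lt; A \<leftarrow> imul yj li; B \<leftarrow> imul yi lj;
       AB \<leftarrow> iadd A B; R \<leftarrow> Lambda_r AB (0, 0); iadd T R }
     else if Lk \<subset> Li \<and> Li \<subset> Lj then do {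
       T \<leftarrow> lt; A \<leftarrow> imul yj li; lj0 \<leftarrow> ihull0 lj; B \<leftarrow> imul yi lj0;
       AB \<leftarrow> iadd A B; R \<leftarrow> Lambda_r AB (0, 0); iadd T R }
     else if Lk \<subset> Lj \<and> Lj \<subset> Li then do {
       T \<leftarrow> lt; li0 \<leftarrow> ihull0 li; A \<leftarrow> imul yj li0; B \<leftarrow> imul yi lj;
       AB \<leftarrow> iadd A B; R \<leftarrow> Lambda_r AB (0, 0); iadd T R }
     else do {
       T \<leftarrow> lt; li0 \<leftarrow> ihull0 li; A \<leftarrow> imul yj li0; lj0 \<leftarrow> ihull0 lj; B \<leftarrow> imul yi lj0;
       TA \<leftarrow> iadd T A; iadd TA B })"

definition mu :: "nat set \<Rightarrow> nat set \<Rightarrow> ival \<Rightarrow> ival calc" where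
  "mu Li Lk li = (if Lk = Li then ret li else ihull0 li)"

text \<open>In the following definitions, \<open>S = [\<Lambda>\<^sub>s([\<nabla>\<^bsub>J\<^esub>y\<^sub>i])]\<close> with \<open>J\<close> the complement of \<open>L\<^sub>k\<close>.\<close>

definition lambda_powNat ::
  "nat \<Rightarrow> nat set \<Rightarrow> nat set \<Rightarrow> ival \<Rightarrow> irect \<Rightarrow> ival \<Rightarrow> nat \<Rightarrow> ival calc" where
  "lambda_powNat n Li Lk yi gi li m = do {
     S \<leftarrow> Lambda_s (nths gi ({..<n} - Lk));
     if Li = {..<n} then do {
       c \<leftarrow> rmul (real m) (real (m - 1));
       P \<leftarrow> ipow yi (m - 2); Q \<leftarrow> iscale c P; imul Q S }
     else do {
       M \<leftarrow> mu Li Lk li;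
       P \<leftarrow> ipow yi (m - 2); Q \<leftarrow> iscale (real m) P;
       A \<leftarrow> iscale (real (m - 1)) S; B \<leftarrow> imul yi M; AB \<leftarrow> iadd A B;
       imul Q AB } }"

definition lambda_oneOver ::
  "nat \<Rightarrow> nat set \<Rightarrow> nat set \<Rightarrow> irect \<Rightarrow> ival \<Rightarrow> ival \<Rightarrow> ival calc" where
  "lambda_oneOver n Li Lk gi li yk = do {
     S \<leftarrow> Lambda_s (nths gi ({..<n} - Lk));
     if Li = {..<n} then do {
       P \<leftarrow> ipow yk 3; Q \<leftarrow> iscale 2 P; imul Q S }
     else do {
       M \<leftarrow> mu Li Lk li;
       P \<leftarrow> ipow yk 2;
       Q \<leftarrow> iscale 2 yk; A \<leftarrow> imul Q S; AM \<leftarrow> isub A M;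
       imul P AM } }"

definition lambda_sqrt ::
  "nat \<Rightarrow> nat set \<Rightarrow> nat set \<Rightarrow> ival \<Rightarrow> irect \<Rightarrow> ival \<Rightarrow> ival \<Rightarrow> ival calc" where
  "lambda_sqrt n Li Lk yi gi li yk = do {
     S \<leftarrow> Lambda_s (nths gi ({..<n} - Lk));
     if Li = {..<n} then do {
       P \<leftarrow> ipow yk 3; Q \<leftarrow> iscale (-4) P; R \<leftarrow> iinv Q; imul R S }
     else do {
       M \<leftarrow> mu Li Lk li;
       P \<leftarrow> iscale 2 yk; R \<leftarrow> iinv P;
       Q \<leftarrow> iscale (-2) yi; R' \<leftarrow> iinv Q; A \<leftarrow> imul R' S; AM \<leftarrow> iadd A M;
       imul R AM } }"

definition lambda_exp ::
  "nat \<Rightarrow> nat set \<Rightarrow> nat set \<Rightarrow> irect \<Rightarrow> ival \<Rightarrow> ival \<Rightarrow> ival calc" where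
  "lambda_exp n Li Lk gi li yk = do {
     S \<leftarrow> Lambda_s (nths gi ({..<n} - Lk));
     if Li = {..<n} then imul yk S
     else do { M \<leftarrow> mu Li Lk li; A \<leftarrow> iadd S M; imul yk A } }"

definition lambda_ln ::
  "nat \<Rightarrow> nat set \<Rightarrow> nat set \<Rightarrow> ival \<Rightarrow> irect \<Rightarrow> ival \<Rightarrow> ival calc" where
  "lambda_ln n Li Lk yi gi li = do {
     S \<leftarrow> Lambda_s (nths gi ({..<n} - Lk));
     if Li = {..<n} then do {
       P \<leftarrow> ipow yi 2; R \<leftarrow> iinv P; Q \<leftarrow> ineg R; imul Q S }
     else do {
       M \<leftarrow> mu Li Lk li;
       R \<leftarrow> iinv yi; A \<leftarrow> imul R S; D \<leftarrow> isub M A;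
       imul R D } }"

subsection \<open>Algorithm S\<close>

record line =
  bnd :: ival
  grad :: irect
  lam :: ival

text \<open>
  \<open>calc_line n S ls k op\<close> calculates line \<open>k\<close>, given by the operation \<open>op\<close>, from the earlier
  lines \<open>ls\<close>; \<open>S\<close> contains the index sets of all lines.
\<close>

fun calc_line :: "nat \<Rightarrow> isets list \<Rightarrow> line list \<Rightarrow> nat \<Rightarrow> oper \<Rightarrow> line calc" where
  "calc_line n S ls k (Add i j) = do {
     y \<leftarrow> iadd (bnd (ls ! i)) (bnd (ls ! j));
     g \<leftarrow> vadd (grad (ls ! i)) (grad (ls ! j));
     l \<leftarrow> lambda_add n (snd (S ! i)) (snd (S ! j)) (lam (ls ! i)) (lam (ls ! j));
     ret \<lparr>bnd = y, grad = g, lam = l\<rparr> }"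
| "calc_line n S ls k (Mul i j) = do {
     y \<leftarrow> imul (bnd (ls ! i)) (bnd (ls ! j));
     g1 \<leftarrow> vmul (bnd (ls ! j)) (grad (ls ! i));
     g2 \<leftarrow> vmul (bnd (ls ! i)) (grad (ls ! j));
     g \<leftarrow> vadd g1 g2;
     l \<leftarrow> lambda_mul n (S ! i) (S ! j) (snd (S ! k))
            (bnd (ls ! i)) (grad (ls ! i)) (lam (ls ! i))
            (bnd (ls ! j)) (grad (ls ! j)) (lam (ls ! j));
     ret \<lparr>bnd = y, grad = g, lam = l\<rparr> }"
| "calc_line n S ls k (PowNat i m) = do {
     y \<leftarrow> ipow (bnd (ls ! i)) m;
     p \<leftarrow> ipow (bnd (ls ! i)) (m - 1);
     q \<leftarrow> iscale (real m) p;
     g \<leftarrow> vmul q (grad (ls ! i));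
     l \<leftarrow> lambda_powNat n (snd (S ! i)) (snd (S ! k))
            (bnd (ls ! i)) (grad (ls ! i)) (lam (ls ! i)) m;
     ret \<lparr>bnd = y, grad = g, lam = l\<rparr> }"
| "calc_line n S ls k (OneOver i) = do {
     y \<leftarrow> iinv (bnd (ls ! i));
     p \<leftarrow> ipow y 2;
     q \<leftarrow> ineg p;
     g \<leftarrow> vmul q (grad (ls ! i));
     l \<leftarrow> lambda_oneOver n (snd (S ! i)) (snd (S ! k)) (grad (ls ! i)) (lam (ls ! i)) y;
     ret \<lparr>bnd = y, grad = g, lam = l\<rparr> }"
| "calc_line n S ls k (Sqrt i) = do {
     y \<leftarrow> isqrt (bnd (ls ! i));
     p \<leftarrow> iscale 2 y;
     q \<leftarrow> iinv p;
     g \<leftarrow> vmul q (grad (ls ! i));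
     l \<leftarrow> lambda_sqrt n (snd (S ! i)) (snd (S ! k))
            (bnd (ls ! i)) (grad (ls ! i)) (lam (ls ! i)) y;
     ret \<lparr>bnd = y, grad = g, lam = l\<rparr> }"
| "calc_line n S ls k (Exp i) = do {
     y \<leftarrow> iexp (bnd (ls ! i));
     g \<leftarrow> vmul y (grad (ls ! i));
     l \<leftarrow> lambda_exp n (snd (S ! i)) (snd (S ! k)) (grad (ls ! i)) (lam (ls ! i)) y;
     ret \<lparr>bnd = y, grad = g, lam = l\<rparr> }"
| "calc_line n S ls k (Ln i) = do {
     y \<leftarrow> iln (bnd (ls ! i));
     q \<leftarrow> iinv (bnd (ls ! i));
     g \<leftarrow> vmul q (grad (ls ! i));
     l \<leftarrow> lambda_ln n (snd (S ! i)) (snd (S ! k))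
            (bnd (ls ! i)) (grad (ls ! i)) (lam (ls ! i));
     ret \<lparr>bnd = y, grad = g, lam = l\<rparr> }"
| "calc_line n S ls k (AddC i c) = do {
     y \<leftarrow> iaddc (bnd (ls ! i)) c;
     l \<leftarrow> ret (if snd (S ! i) = {..<n} then (0, 0) else lam (ls ! i));
     ret \<lparr>bnd = y, grad = grad (ls ! i), lam = l\<rparr> }"
| "calc_line n S ls k (MulByC c i) = do {
     y \<leftarrow> iscale c (bnd (ls ! i));
     g \<leftarrow> vscale c (grad (ls ! i));
     l \<leftarrow> (if snd (S ! i) = {..<n} then ret (0, 0) else iscale c (lam (ls ! i)));
     ret \<lparr>bnd = y, grad = g, lam = l\<rparr> }"

fun calc_lines :: "nat \<Rightarrow> isets list \<Rightarrow> line list \<Rightarrow> codelist \<Rightarrow> line list calc" where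
  "calc_lines n S ls [] = ret ls"
| "calc_lines n S ls (c # cs) = do {
     l \<leftarrow> calc_line n S ls (length ls) c;
     calc_lines n S (ls @ [l]) cs }"

definition unit_rect :: "nat \<Rightarrow> nat \<Rightarrow> irect" where
  "unit_rect n k = map (\<lambda>i. if i = k then (1, 1) else (0, 0)) [0..<n]"

definition initial_lines :: "nat \<Rightarrow> (nat \<Rightarrow> real) \<Rightarrow> (nat \<Rightarrow> real) \<Rightarrow> line list" where
  "initial_lines n a b =
     map (\<lambda>k. \<lparr>bnd = (a k, b k), grad = unit_rect n k, lam = (0, 0)\<rparr>) [0..<n]"

text \<open>
  The result on the hyperrectangle \<^term>\<open>hyperrect n a b\<close> is the triple
  \<open>([\<phi>], [\<nabla>\<phi>], [\<lambda>\<^sub>\<phi>])\<close>.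
\<close>

definition algorithm_S ::
  "nat \<Rightarrow> codelist \<Rightarrow> (nat \<Rightarrow> real) \<Rightarrow> (nat \<Rightarrow> real) \<Rightarrow> (ival \<times> irect \<times> ival) calc" where
  "algorithm_S n cs a b = (let S = codelist_isets n cs; L = snd (last S) in do {
     ls \<leftarrow> calc_lines n S (initial_lines n a b) cs;
     l \<leftarrow> (if L = {} then ret (lam (last ls))
           else if L = {..<n} then ret (0, 0)
           else ihull0 (lam (last ls)));
     ret (bnd (last ls), grad (last ls), l) })"

end

theory Submission
  imports Defs
begin

text \<open>
  A line of the codelist is calculated from a bounded number of interval operations on single
  intervals, each of constant cost, and of componentwise operations, inner products and sums of
  squares over the gradients of its operands. Gradients have at most \<open>n\<close> components, and the parts
  \<open>[\<nabla>\<^sub>J y]\<close> selected by the index sets are no longer, so the operators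
  \<open>\<Lambda>\<^sub>s\<close> and \<open>\<Lambda>\<^sub>t\<close> are linear in \<open>n\<close> as well: they bound the eigenvalues of the \<open>n \<times> n\<close> matrices
  behind them without forming a matrix. Hence one line
  costs \<open>O(n)\<close> (lemma \<open>calc_line_within\<close>), and \<open>t\<close> lines cost \<open>O(n) t\<close>.

  There remain the at most two operations of the last step. For \<open>t \<ge> 1\<close> they are absorbed into the
  cost of a line. For \<open>t = 0\<close> the bound is \<open>0\<close>, so they must not occur at all: the last line is then
  the variable \<open>x\<^sub>n\<close>, whose set \<open>L\<close> consists of all indices, and the result \<open>[0, 0]\<close> is free.
\<close>

section \<open>Bounds on the cost of a calculation\<close>

text \<open>
  Costs and results are bounded together, because the cost of a vector operation depends on the
  length of a list that an earlier operation has calculated. Undefined calculations satisfy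
  every bound.
\<close>

definition cost_within :: "nat \<Rightarrow> ('a \<Rightarrow> bool) \<Rightarrow> 'a calc \<Rightarrow> bool" where
  "cost_within N P c \<longleftrightarrow> (\<forall>v M. c = Calc v M \<longrightarrow> M \<le> N \<and> P v)"

lemma withinD: "cost_within N P (Calc v M) \<Longrightarrow> M \<le> N \<and> P v"
  by (simp add: cost_within_def)

lemma within_le: "cost_within N P c \<Longrightarrow> N \<le> M \<Longrightarrow> cost_within M P c"
  by (auto simp: cost_within_def)

lemma within_if: "cost_within N P c \<Longrightarrow> cost_within N P d \<Longrightarrow> cost_within N P (if b then c else d)"
  by simp

text \<open>
  Applied backwards to a calculation whose bound is a schematic variable, the composition rule
  determines the bound as the sum of the bounds of the single steps. Most cost estimates below
  therefore weaken to an unknown bound by \<open>within_le\<close> first, and compare the resulting sum with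
  the stated bound at the end.
\<close>

lemma within_bind:
  assumes "cost_within N P c" and "\<And>v. P v \<Longrightarrow> cost_within M Q (f v)"
  shows "cost_within (N + M) Q (calc_bind c f)"
  using assms by (cases c) (fastforce simp: cost_within_def split: calc.splits)+

lemma within_ret: "P v \<Longrightarrow> cost_within 0 P (ret v)"
  by (simp add: cost_within_def ret_def)

lemma within_require: "cost_within 0 (\<lambda>_. True) (require b)"
  by (simp add: cost_within_def require_def)

lemma within_real_operations:
  "cost_within 1 (\<lambda>_. True) (radd x y)" "cost_within 1 (\<lambda>_. True) (rsub x y)"
  "cost_within 1 (\<lambda>_. True) (rmul x y)" "cost_within 1 (\<lambda>_. True) (rdiv x y)"
  "cost_within 1 (\<lambda>_. True) (rpow x m)" "cost_within 1 (\<lambda>_. True) (rsqrt x)"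
  "cost_within 1 (\<lambda>_. True) (rexp x)" "cost_within 1 (\<lambda>_. True) (rln x)"
  "cost_within 1 (\<lambda>_. True) (rmin x y)" "cost_within 1 (\<lambda>_. True) (rmax x y)"
  "cost_within 1 (\<lambda>_. True) (rless x y)" "cost_within 1 (\<lambda>_. True) (rleq x y)"
  by (simp_all add: cost_within_def radd_def rsub_def rmul_def rdiv_def rpow_def rsqrt_def rexp_def
      rln_def rmin_def rmax_def rless_def rleq_def)

lemmas within_basic = within_bind within_ret within_require within_real_operations

section \<open>Operations on intervals\<close>

lemma iadd_within: "cost_within 2 (\<lambda>_. True) (iadd A B)"
  by (cases A; cases B; simp only: iadd.simps)
    (rule within_le, (rule within_basic | simp)+)

lemma imul_within: "cost_within 10 (\<lambda>_. True) (imul A B)"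
  by (cases A; cases B; simp only: imul.simps)
    (rule within_le, (rule within_basic | simp)+)

lemma iinv_within: "cost_within 2 (\<lambda>_. True) (iinv A)"
  by (cases A; simp only: iinv.simps)
    (rule within_le, (rule within_basic | simp)+)

lemma ipow_within: "cost_within 5 (\<lambda>_. True) (ipow A m)"
proof -
  obtain l u where A: "A = (l, u)" by (cases A)
  have "cost_within 2 (\<lambda>_. True)
      (calc_bind (rless u 0) (\<lambda>neg. if neg then ret (x, y)
         else calc_bind (rmax y x) (\<lambda>w. ret (0, w))))" for x y :: real
    by (auto simp: cost_within_def rless_def rmax_def ret_def)
  then show ?thesis
    by (auto simp: A cost_within_def rpow_def rless_def rmax_def ret_def split: if_splits)
qed

lemma isqrt_within: "cost_within 2 (\<lambda>_. True) (isqrt A)"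
  by (cases A; simp only: isqrt.simps)
    (rule within_le, (rule within_basic | simp)+)

lemma iexp_within: "cost_within 2 (\<lambda>_. True) (iexp A)"
  by (cases A; simp only: iexp.simps)
    (rule within_le, (rule within_basic | simp)+)

lemma iln_within: "cost_within 2 (\<lambda>_. True) (iln A)"
  by (cases A; simp only: iln.simps)
    (rule within_le, (rule within_basic | simp)+)

lemma iaddc_within: "cost_within 2 (\<lambda>_. True) (iaddc A c)"
  by (cases A; simp only: iaddc.simps)
    (rule within_le, (rule within_basic | simp)+)

lemma iscale_within: "cost_within 3 (\<lambda>_. True) (iscale c A)"
  by (cases A; simp only: iscale.simps)
    (rule within_le, (rule within_basic | simp)+)

lemma ineg_within: "cost_within 3 (\<lambda>_. True) (ineg A)"
  by (simp only: ineg_def iscale_within)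

lemma isub_within: "cost_within 5 (\<lambda>_. True) (isub A B)"
  unfolding isub_def
  by (rule within_le, (rule within_basic iscale_within iadd_within | simp)+)

lemma ihull0_within: "cost_within 2 (\<lambda>_. True) (ihull0 A)"
  by (cases A; simp only: ihull0.simps)
    (rule within_le, (rule within_basic | simp)+)

lemma max_square_within: "cost_within 3 (\<lambda>_. True) (max_square A)"
  by (cases A; simp only: max_square.simps)
    (rule within_le, (rule within_basic | simp)+)

lemma Lambda_r_within: "cost_within 2 (\<lambda>_. True) (Lambda_r A B)"
  by (cases A; cases B; simp only: Lambda_r.simps)
    (rule within_le, (rule within_basic | simp)+)

lemma Lambda_star_within: "cost_within 19 (\<lambda>_. True) (Lambda_star A B C)"
  by (cases A; cases B; simp only: Lambda_star.simps)
    (rule within_le, (rule within_basic max_square_within iscale_within | simp)+)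

lemma mu_within: "cost_within 2 (\<lambda>_. True) (mu Li Lk li)"
  using ihull0_within by (auto simp: mu_def cost_within_def ret_def)

lemmas within_interval =
  iadd_within imul_within iinv_within ipow_within isqrt_within iexp_within iln_within
  iaddc_within iscale_within ineg_within isub_within ihull0_within max_square_within
  Lambda_r_within Lambda_star_within mu_within

section \<open>Operations on hyperrectangles\<close>

lemma calc_map_within:
  assumes "\<And>x. cost_within N (\<lambda>_. True) (f x)"
  shows "cost_within (N * length xs) (\<lambda>ys. length ys = length xs) (calc_map f xs)"
proof (induction xs)
  case Nil
  show ?case by (simp add: within_ret)
next
  case (Cons x xs)
  show ?case
    unfolding calc_map.simps
    by (rule within_le, (rule within_basic assms Cons.IH | simp)+)
qed

lemma calc_map_within_le:
  assumes "\<And>x. cost_within N (\<lambda>_. True) (f x)" and "length xs \<le> n"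
  shows "cost_within (N * n) (\<lambda>ys. length ys \<le> n) (calc_map f xs)"
proof -
  have "cost_within (N * length xs) (\<lambda>ys. length ys = length xs) (calc_map f xs)"
    by (rule calc_map_within) (rule assms(1))
  then have "cost_within (N * length xs) (\<lambda>ys. length ys \<le> n) (calc_map f xs)"
    using assms(2) by (simp add: cost_within_def)
  then show ?thesis
    by (rule within_le) (use assms(2) in simp)
qed

lemma calc_map2_within_le:
  assumes "\<And>x y. cost_within N (\<lambda>_. True) (f x y)" and "length xs \<le> n"
  shows "cost_within (N * n) (\<lambda>zs. length zs \<le> n) (calc_map2 f xs ys)"
  unfolding calc_map2_def
  by (rule calc_map_within_le) (use assms in \<open>auto split: prod.splits\<close>)

lemma calc_sum_within:
  assumes f: "\<And>x y. cost_within N (\<lambda>_. True) (f x y)" and "length xs \<le> n"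
  shows "cost_within (N * n) (\<lambda>_. True) (calc_sum f z xs)"
proof -
  have "cost_within (N * length xs) (\<lambda>_. True) (calc_sum f z xs)"
  proof (induction xs rule: induct_list012)
    case 1
    show ?case by (simp add: within_ret)
  next
    case (2 x)
    show ?case by (simp add: cost_within_def ret_def)
  next
    case (3 x y xs)
    show ?case
      unfolding calc_sum.simps
      by (rule within_le, (rule within_bind f 3 | simp)+)
  qed
  then show ?thesis
    by (rule within_le) (use assms(2) in simp)
qed

lemma vadd_within: "length g \<le> n \<Longrightarrow> cost_within (2 * n) (\<lambda>v. length v \<le> n) (vadd g h)"
  unfolding vadd_def by (rule calc_map2_within_le) (rule iadd_within)

lemma vmul_within: "length g \<le> n \<Longrightarrow> cost_within (10 * n) (\<lambda>v. length v \<le> n) (vmul A g)"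
  unfolding vmul_def by (rule calc_map_within_le) (rule imul_within)

lemma vscale_within: "length g \<le> n \<Longrightarrow> cost_within (3 * n) (\<lambda>v. length v \<le> n) (vscale c g)"
  unfolding vscale_def by (rule calc_map_within_le) (rule iscale_within)

lemma sum_max_squares_within:
  assumes "length g \<le> n"
  shows "cost_within (4 * n) (\<lambda>_. True) (sum_max_squares g)"
  unfolding sum_max_squares_def
  by (rule within_le,
      (rule within_bind calc_map_within_le[where n = n] calc_sum_within[where n = n]
          max_square_within within_real_operations
        | use assms in simp)+)

lemma Lambda_s_within:
  assumes "length g \<le> n"
  shows "cost_within (4 * n + 5) (\<lambda>_. True) (Lambda_s g)"
  unfolding Lambda_s_def
  apply (rule within_if)
   apply (rule within_le, rule ipow_within, simp)
  apply (rule within_le,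
      (rule within_basic sum_max_squares_within
        | use assms in simp)+)
  done

lemma Lambda_t_within:
  assumes "length g \<le> n" and "length h \<le> n"
  shows "cost_within (20 * n + 13) (\<lambda>_. True) (Lambda_t g h)"
  unfolding Lambda_t_def
  apply (rule within_if)
   apply (rule within_le, (rule within_bind within_interval | simp)+)[1]
  apply (rule within_le,
      (rule within_basic sum_max_squares_within[where n = n] within_interval
          calc_map2_within_le[where n = n] calc_sum_within[where n = n]
        | use assms in simp)+)
  done

lemma length_nths_le: "length g \<le> n \<Longrightarrow> length (nths g J) \<le> n"
  unfolding length_nths
  by (rule order_trans[OF card_mono[of "{..<length g}"]]) auto

section \<open>The cost of one line\<close>

text \<open>
  The index sets only select an alternative and shorten the gradients. Each bound is a common one
  for all alternatives, with gradients of full length \<open>n\<close>.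
\<close>

lemma lambda_add_within: "cost_within 6 (\<lambda>_. True) (lambda_add n Li Lj li lj)"
  unfolding lambda_add_def Let_def
  apply (intro within_if)
  apply ((rule within_le, (rule within_basic within_interval | simp)+)[1])+
  done

lemma lambda_mul_within:
  assumes "length gi \<le> n" and "length gj \<le> n"
  shows "cost_within (20 * n + 60) (\<lambda>_. True) (lambda_mul n Si Sj Lk yi gi li yj gj lj)"
  unfolding lambda_mul_def Let_def split_beta
  apply (intro within_if)
  apply ((rule within_le,
      (rule within_basic within_interval Lambda_t_within[where n = n]
        | use assms in \<open>simp add: length_nths_le\<close>)+)[1])+
  done

lemma lambda_powNat_within:
  assumes "length gi \<le> n"
  shows "cost_within (4 * n + 40) (\<lambda>_. True) (lambda_powNat n Li Lk yi gi li m)"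
  unfolding lambda_powNat_def
  apply (cases "Li = {..<n}"; simp only: if_True if_False)
  apply ((rule within_le,
      (rule within_basic within_interval Lambda_s_within[where n = n]
        | use assms in \<open>simp add: length_nths_le\<close>)+)[1])+
  done

lemma lambda_oneOver_within:
  assumes "length gi \<le> n"
  shows "cost_within (4 * n + 40) (\<lambda>_. True) (lambda_oneOver n Li Lk gi li yk)"
  unfolding lambda_oneOver_def
  apply (cases "Li = {..<n}"; simp only: if_True if_False)
  apply ((rule within_le,
      (rule within_basic within_interval Lambda_s_within[where n = n]
        | use assms in \<open>simp add: length_nths_le\<close>)+)[1])+
  done

lemma lambda_sqrt_within:
  assumes "length gi \<le> n"
  shows "cost_within (4 * n + 40) (\<lambda>_. True) (lambda_sqrt n Li Lk yi gi li yk)"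
  unfolding lambda_sqrt_def
  apply (cases "Li = {..<n}"; simp only: if_True if_False)
  apply ((rule within_le,
      (rule within_basic within_interval Lambda_s_within[where n = n]
        | use assms in \<open>simp add: length_nths_le\<close>)+)[1])+
  done

lemma lambda_exp_within:
  assumes "length gi \<le> n"
  shows "cost_within (4 * n + 40) (\<lambda>_. True) (lambda_exp n Li Lk gi li yk)"
  unfolding lambda_exp_def
  apply (cases "Li = {..<n}"; simp only: if_True if_False)
  apply ((rule within_le,
      (rule within_basic within_interval Lambda_s_within[where n = n]
        | use assms in \<open>simp add: length_nths_le\<close>)+)[1])+
  done

lemma lambda_ln_within:
  assumes "length gi \<le> n"
  shows "cost_within (4 * n + 40) (\<lambda>_. True) (lambda_ln n Li Lk yi gi li)"
  unfolding lambda_ln_def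
  apply (cases "Li = {..<n}"; simp only: if_True if_False)
  apply ((rule within_le,
      (rule within_basic within_interval Lambda_s_within[where n = n]
        | use assms in \<open>simp add: length_nths_le\<close>)+)[1])+
  done

lemmas within_lambda =
  lambda_add_within lambda_mul_within lambda_powNat_within lambda_oneOver_within
  lambda_sqrt_within lambda_exp_within lambda_ln_within

text \<open>
  Multiplication is the most expensive operation, and it determines the constants. The length of
  the calculated gradient is bounded along with the cost, since later lines depend on it.
\<close>

lemma calc_line_within:
  assumes "wf_oper k op"
    and grad: "\<And>i. i < k \<Longrightarrow> length (grad (ls ! i)) \<le> n"
  shows "cost_within (42 * n + 70) (\<lambda>l. length (grad l) \<le> n) (calc_line n S ls k op)"
proof -
  have mulByC: "cost_within 3 (\<lambda>_. True) (if b then ret (0, 0) else iscale c A)" for b c A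
    using iscale_within by (auto simp: cost_within_def ret_def)
  show ?thesis
    using assms(1)
    apply (cases op; simp only: calc_line.simps wf_oper.simps)
    \<comment> \<open>The trivial instance of the rule for \<open>ret\<close> comes first: it fixes the unknown postcondition
      of an intermediate \<open>ret\<close>, and fails to match the final one.\<close>
    apply ((rule within_le,
        (rule within_bind within_lambda within_interval mulByC vadd_within[where n = n]
            vmul_within[where n = n] vscale_within[where n = n]
            within_ret[where P = "\<lambda>_. True"] within_ret
          | simp add: grad)+)[1])+
    done
qed

section \<open>The cost of the algorithm\<close>

lemma calc_lines_within:
  assumes "\<And>p. p < length cs \<Longrightarrow> wf_oper (length ls + p) (cs ! p)"
    and "\<And>i. i < length ls \<Longrightarrow> length (grad (ls ! i)) \<le> n"
  shows "cost_within (length cs * (42 * n + 70)) (\<lambda>_. True) (calc_lines n S ls cs)"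
  using assms
proof (induction cs arbitrary: ls)
  case Nil
  show ?case by (simp add: within_ret)
next
  case (Cons c cs)
  have "cost_within (42 * n + 70) (\<lambda>l. length (grad l) \<le> n) (calc_line n S ls (length ls) c)"
    using Cons.prems(1)[of 0] by (intro calc_line_within Cons.prems(2)) simp_all
  moreover have "cost_within (length cs * (42 * n + 70)) (\<lambda>_. True) (calc_lines n S (ls @ [l]) cs)"
    if "length (grad l) \<le> n" for l
  proof (rule Cons.IH)
    show "wf_oper (length (ls @ [l]) + p) (cs ! p)" if "p < length cs" for p
      using Cons.prems(1)[of "Suc p"] that by simp
    show "length (grad ((ls @ [l]) ! i)) \<le> n" if "i < length (ls @ [l])" for i
      using Cons.prems(2) that \<open>length (grad l) \<le> n\<close> by (auto simp: nth_append less_Suc_eq)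
  qed
  ultimately show ?case
    unfolding calc_lines.simps by (rule within_le[OF within_bind]) (simp_all add: algebra_simps)
qed

lemma algorithm_S_within:
  assumes "wf_codelist n cs" and "1 \<le> n"
  shows "cost_within (114 * n * length cs) (\<lambda>_. True) (algorithm_S n cs a b)"
proof -
  define S where "S = codelist_isets n cs"
  define L where "L = snd (last S)"
  define finish where
    "finish ls = (if L = {} then ret (lam (last ls))
       else if L = {..<n} then ret (0, 0) else ihull0 (lam (last ls)))" for ls :: "line list"
  define K :: nat where "K = (if cs = [] then 0 else 2)"
  have finish: "cost_within K (\<lambda>_. True) (finish ls)" for ls
  proof (cases "cs = []")
    case True
    have "last [0..<n] = n - 1"
      using \<open>1 \<le> n\<close> by (cases n) simp_all
    then have "L = {..<n}"
      using True \<open>1 \<le> n\<close> by (simp add: L_def S_def codelist_isets_def last_map)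
    then show ?thesis
      using True by (simp add: finish_def K_def within_ret)
  next
    case False
    show ?thesis
      using ihull0_within False by (auto simp: finish_def K_def cost_within_def ret_def)
  qed
  have lines: "cost_within (length cs * (42 * n + 70)) (\<lambda>_. True)
      (calc_lines n S (initial_lines n a b) cs)"
    by (rule calc_lines_within)
      (use assms(1) in \<open>simp_all add: wf_codelist_def initial_lines_def unit_rect_def\<close>)
  have alg: "algorithm_S n cs a b =
      calc_bind (calc_lines n S (initial_lines n a b) cs) (\<lambda>ls.
      calc_bind (finish ls) (\<lambda>l. ret (bnd (last ls), grad (last ls), l)))"
    by (simp only: algorithm_S_def finish_def L_def S_def Let_def)
  \<comment> \<open>The last step costs at most two operations, charged here as two operations to every line.\<close>
  have "K \<le> 2 * length cs"
    by (cases cs) (simp_all add: K_def)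
  then have "length cs * (42 * n + 70) + (K + 0) \<le> length cs * (42 * n + 70) + 2 * length cs"
    by simp
  also have "\<dots> = length cs * (42 * n + 72)"
    by (simp add: distrib_left)
  also have "\<dots> \<le> length cs * (114 * n)"
    using \<open>1 \<le> n\<close> by (intro mult_le_mono2) simp
  also have "\<dots> = 114 * n * length cs"
    by (rule mult.commute)
  finally have "length cs * (42 * n + 70) + (K + 0) \<le> 114 * n * length cs" .
  then show ?thesis
    unfolding alg
    by (rule within_le[OF within_bind[OF lines within_bind[OF finish within_ret]], rotated]) simp
qed

theorem proposition4p19:
  shows "\<exists>f :: nat \<Rightarrow> real. f \<in> O(\<lambda>n. real n) \<and>
    (\<forall>(n::nat) (U :: (nat \<Rightarrow> real) set) (\<phi> :: (nat \<Rightarrow> real) \<Rightarrow> real) (cs :: codelist)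
       (a :: nat \<Rightarrow> real) (b :: nat \<Rightarrow> real) (Y :: ival) (G :: irect) (L :: ival) (N :: nat).
       1 \<le> n \<longrightarrow> openin (Euclidean_space n) U \<longrightarrow> C2_on n U \<phi> \<longrightarrow>
       is_codelist_of n U \<phi> cs \<longrightarrow>
       (\<forall>i<n. a i \<le> b i) \<longrightarrow> hyperrect n a b \<subseteq> U \<longrightarrow>
       algorithm_S n cs a b = Calc (Y, G, L) N \<longrightarrow>
       real N \<le> f n * real (codelist_ops cs))"
proof (intro exI[of _ "\<lambda>n. real (114 * n)"] conjI allI impI)
  show "(\<lambda>n. real (114 * n)) \<in> O(\<lambda>n. real n)"
    by simp
next
  fix n U \<phi> cs a b Y G L N
  assume "1 \<le> n" and "is_codelist_of n U \<phi> cs" and alg: "algorithm_S n cs a b = Calc (Y, G, L) N"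
  then have "cost_within (114 * n * length cs) (\<lambda>_. True) (Calc (Y, G, L) N)"
    using algorithm_S_within[of n cs a b] by (simp add: is_codelist_of_def)
  then have "N \<le> 114 * n * length cs"
    by (blast dest: withinD)
  then have "real N \<le> real (114 * n * length cs)"
    by (rule of_nat_mono)
  then show "real N \<le> real (114 * n) * real (codelist_ops cs)"
    by (simp only: codelist_ops_def of_nat_mult)
qed

end
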